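(* (Interpolation.) Let $a,b\in\mathbb R$ with $d(a-jh,b-ih)\neq0$ for $0\le i\le j\le n-1$. Let $G\in\pi_n(\gamma_1,\gamma_2)$ with control points $P_0,\ldots,P_n$ over the interval $[a,b]$. If $b=a-nh$ and $h\neq0$, then $G$ interpolates all its control points; in particular, $G(a-kh)=P_k$ for $k=0,\ldots,n$.
   Context: Let $n\ge 1$ be an integer and $h\in\mathbb R$ fixed. Let $\gamma_1,\gamma_2:\mathbb R\to\mathbb R$ be continuous, linearly independent functions. They are assumed translation invariant: for every $s\in\mathbb R$ there is an invertible $2\times2$ matrix $C(s)$ with $\begin{pmatrix}\gamma_1(x-s)\\ \gamma_2(x-s)\end{pmatrix}=C(s)\begin{pmatrix}\gamma_1(x)\\ \gamma_2(x)\end{pmatrix}$ for all $x$. Put $\pi_n(\gamma_1,\gamma_2)=\mathrm{span}\{\gamma_1^{n-k}\gamma_2^{k}\}_{k=0}^n$ and $d(u,v)=\gamma_1(u)\gamma_2(v)-\gamma_2(u)\gamma_1(v)$. For $0\le k\le n$ put $G_{n,k}(t;h)=\sum_{I\subseteq\{1,\ldots,n\},\,|I|=k}\ \prod_{i\in I}\gamma_1(t-(i-1)h)\prod_{i\in\{1,\ldots,n\}\setminus I}\gamma_2(t-(i-1)h)$. Standing assumption: $h$ is such that the functions $t\mapsto G_{n,k}(t;h)$, $k=0,\ldots,n$, are linearly independent. $h$--$\gamma$ Bernstein basis functions: $[a,b]$ denotes the interval determined by the endpoints $a,b$ in either order. Take arbitrary initial values $P_0^0,\ldots,P_n^0$ and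 define $$P_i^{k+1}(x)=\frac{d(x-kh,b-ih)}{d(a-(i+k)h,b-ih)}P_i^k(x)+\frac{d(a-(i+k)h,x-kh)}{d(a-(i+k)h,b-ih)}P_{i+1}^k(x),\quad 0\le i\le n-k-1,\ 0\le k\le n-1.$$ $B_k^n(x,[a,b];\gamma,h)$ is by definition the coefficient of $P_k^0$ in $P_0^n(x)$: $P_0^n(x)=\sum_{k=0}^nP_k^0\,B_k^n(x,[a,b];\gamma,h)$. The control points of $G$ over $[a,b]$ are the coefficients $P_k$ in $G(x)=\sum_{k=0}^nP_k\,B_k^n(x,[a,b];\gamma,h)$. *)

theory Defs
  imports "HOL-Analysis.Analysis" "HOL-Library.Function_Algebras"
begin

global_interpretation real_fun: vector_space "\<lambda>(c::real) (f::real \<Rightarrow> real) x. c * f x"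
  by unfold_locales (auto simp: fun_eq_iff algebra_simps)

text \<open>Linear independence of an indexed family: the injectivity clause excludes repetitions, which
  independence of the range, being a property of a set, would not detect.\<close>

definition lin_indep_family :: "('i \<Rightarrow> real \<Rightarrow> real) \<Rightarrow> 'i set \<Rightarrow> bool" where
  "lin_indep_family f I \<longleftrightarrow> inj_on f I \<and> \<not> real_fun.dependent (f ` I)"

lemma sum_fun_apply: "(\<Sum>i\<in>A. f i) x = (\<Sum>i\<in>A. f i x :: real)"
  for f :: "'i \<Rightarrow> 'a \<Rightarrow> real"
  by (induction A rule: infinite_finite_induct) auto

lemma lin_indep_family_iff:
  assumes "finite I"
  shows "lin_indep_family f I \<longleftrightarrow>
    (\<forall>c. (\<forall>x. (\<Sum>i\<in>I. c i * f i x) = 0) \<longrightarrow> (\<forall>i\<in>I. c i = 0))"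
proof -
  have z: "(\<forall>x. (\<Sum>i\<in>I. c i * f i x) = 0) \<longleftrightarrow> (\<Sum>i\<in>I. (\<lambda>x. c i * f i x)) = 0" for c
    by (simp add: fun_eq_iff sum_fun_apply)
  show ?thesis
  proof
    assume L: "lin_indep_family f I"
    then have inj: "inj_on f I" and ind: "\<not> real_fun.dependent (f ` I)"
      by (auto simp: lin_indep_family_def)
    show "\<forall>c. (\<forall>x. (\<Sum>i\<in>I. c i * f i x) = 0) \<longrightarrow> (\<forall>i\<in>I. c i = 0)"
    proof (intro allI impI)
      fix c assume "\<forall>x. (\<Sum>i\<in>I. c i * f i x) = 0"
      then have "(\<Sum>i\<in>I. (\<lambda>x. c i * f i x)) = 0" by (simp only: z)
      moreover have "(\<Sum>v\<in>f ` I. (\<lambda>x. c (inv_into I f v) * v x)) = (\<Sum>i\<in>I. (\<lambda>x. c i * f i x))"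
        using inj by (simp add: sum.reindex)
      ultimately have sum0: "(\<Sum>v\<in>f ` I. (\<lambda>x. c (inv_into I f v) * v x)) = 0"
        by (rule trans[rotated])
      have "c (inv_into I f v) = 0" if "v \<in> f ` I" for v
        by (rule real_fun.independentD[OF ind finite_imageI[OF assms] subset_refl sum0 that])
      then show "\<forall>i\<in>I. c i = 0" using inj by (metis imageI inv_into_f_f)
    qed
  next
    assume R: "\<forall>c. (\<forall>x. (\<Sum>i\<in>I. c i * f i x) = 0) \<longrightarrow> (\<forall>i\<in>I. c i = 0)"
    have inj: "inj_on f I"
    proof (rule inj_onI, rule ccontr)
      fix i j assume ij: "i \<in> I" "j \<in> I" "f i = f j" "i \<noteq> j"
      let ?c = "\<lambda>l. (if l = i then 1 else 0) - (if l = j then 1 else 0) :: real"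
      have "(\<Sum>l\<in>I. ?c l * f l x) = 0" for x
      proof -
        have "(\<Sum>l\<in>I. ?c l * f l x)
            = (\<Sum>l\<in>I. if l = i then f l x else 0) - (\<Sum>l\<in>I. if l = j then f l x else 0)"
          by (subst sum_subtractf[symmetric], rule sum.cong) auto
        also have "\<dots> = 0" using ij assms by simp
        finally show ?thesis .
      qed
      then have "?c i = 0" by (rule R[rule_format, of ?c i, OF _ ij(1)])
      then show False using ij(4) by simp
    qed
    moreover have "\<not> real_fun.dependent (f ` I)"
    proof (subst real_fun.dependent_finite)
      show "\<nexists>u. (\<exists>v\<in>f ` I. u v \<noteq> 0) \<and> (\<Sum>v\<in>f ` I. (\<lambda>x. u v * v x)) = 0"
      proof
        assume "\<exists>u. (\<exists>v\<in>f ` I. u v \<noteq> 0) \<and> (\<Sum>v\<in>f ` I. (\<lambda>x. u v * v x)) = 0"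
        then obtain u where u: "\<exists>v\<in>f ` I. u v \<noteq> 0" "(\<Sum>v\<in>f ` I. (\<lambda>x. u v * v x)) = 0"
          by blast
        from u(2) inj have "(\<Sum>i\<in>I. (\<lambda>x. u (f i) * f i x)) = 0"
          by (simp add: sum.reindex)
        then have "\<forall>x. (\<Sum>i\<in>I. u (f i) * f i x) = 0"
          by (simp only: z[of "\<lambda>i. u (f i)"])
        then have "\<forall>i\<in>I. u (f i) = 0" by (rule R[THEN spec, THEN mp])
        with u(1) show False by auto
      qed
    qed (use assms in simp)
    ultimately show "lin_indep_family f I" by (simp add: lin_indep_family_def)
  qed
qed

definition translation_invariant :: "(real \<Rightarrow> real) \<Rightarrow> (real \<Rightarrow> real) \<Rightarrow> bool" where
  "translation_invariant \<gamma>1 \<gamma>2 \<longleftrightarrow>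
     (\<forall>s. \<exists>C :: real^2^2. invertible C \<and>
        (\<forall>x. vector [\<gamma>1 (x - s), \<gamma>2 (x - s)] = C *v vector [\<gamma>1 x, \<gamma>2 x]))"

definition gamma_space :: "nat \<Rightarrow> (real \<Rightarrow> real) \<Rightarrow> (real \<Rightarrow> real) \<Rightarrow> (real \<Rightarrow> real) set" where
  "gamma_space n \<gamma>1 \<gamma>2 = real_fun.span ((\<lambda>k x. \<gamma>1 x ^ (n - k) * \<gamma>2 x ^ k) ` {0..n})"

definition gamma_det :: "(real \<Rightarrow> real) \<Rightarrow> (real \<Rightarrow> real) \<Rightarrow> real \<Rightarrow> real \<Rightarrow> real" where
  "gamma_det \<gamma>1 \<gamma>2 u v = \<gamma>1 u * \<gamma>2 v - \<gamma>2 u * \<gamma>1 v"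

definition G_fun :: "(real \<Rightarrow> real) \<Rightarrow> (real \<Rightarrow> real) \<Rightarrow> real \<Rightarrow> nat \<Rightarrow> nat \<Rightarrow> real \<Rightarrow> real" where
  "G_fun \<gamma>1 \<gamma>2 h n k t =
     (\<Sum>I | I \<subseteq> {1..n} \<and> card I = k.
        (\<Prod>i\<in>I. \<gamma>1 (t - (real i - 1) * h)) * (\<Prod>i\<in>{1..n} - I. \<gamma>2 (t - (real i - 1) * h)))"

text \<open>\<open>hg_alg \<gamma>1 \<gamma>2 h a b P k i x\<close> is \<open>P\<^sub>i\<^sup>k(x)\<close> for the initial values \<open>P\<close>. The recursion does not
  restrict \<open>i\<close>; the value at level \<open>n\<close> and index \<open>0\<close> only uses entries with \<open>i + k \<le> n\<close>.\<close>

primrec hg_alg :: "(real \<Rightarrow> real) \<Rightarrow> (real \<Rightarrow> real) \<Rightarrow> real \<Rightarrow> real \<Rightarrow> real \<Rightarrow> (nat \<Rightarrow> real) \<Rightarrow>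
    nat \<Rightarrow> nat \<Rightarrow> real \<Rightarrow> real" where
  "hg_alg \<gamma>1 \<gamma>2 h a b P 0 i x = P i"
| "hg_alg \<gamma>1 \<gamma>2 h a b P (Suc k) i x =
     gamma_det \<gamma>1 \<gamma>2 (x - real k * h) (b - real i * h)
       / gamma_det \<gamma>1 \<gamma>2 (a - real (i + k) * h) (b - real i * h)
       * hg_alg \<gamma>1 \<gamma>2 h a b P k i x
   + gamma_det \<gamma>1 \<gamma>2 (a - real (i + k) * h) (x - real k * h)
       / gamma_det \<gamma>1 \<gamma>2 (a - real (i + k) * h) (b - real i * h)
       * hg_alg \<gamma>1 \<gamma>2 h a b P k (Suc i) x"

text \<open>The coefficient of the \<open>k\<close>-th initial value in the linear form \<open>P \<mapsto> P\<^sub>0\<^sup>n(x)\<close>, obtained as the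
  value of that form at the \<open>k\<close>-th unit vector; see \<open>hg_alg_expansion\<close> and \<open>hg_bernstein_unique\<close>.\<close>

definition hg_bernstein :: "(real \<Rightarrow> real) \<Rightarrow> (real \<Rightarrow> real) \<Rightarrow> real \<Rightarrow> real \<Rightarrow> real \<Rightarrow>
    nat \<Rightarrow> nat \<Rightarrow> real \<Rightarrow> real" where
  "hg_bernstein \<gamma>1 \<gamma>2 h a b n k x = hg_alg \<gamma>1 \<gamma>2 h a b (\<lambda>j. if j = k then 1 else 0) n 0 x"

lemma hg_alg_linear:
  "hg_alg \<gamma>1 \<gamma>2 h a b P m i x =
     (\<Sum>k=i..i+m. P k * hg_alg \<gamma>1 \<gamma>2 h a b (\<lambda>j. if j = k then 1 else 0) m i x)"
proof (induction m arbitrary: i P)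
  case 0
  show ?case by simp
next
  case (Suc m)
  let ?e = "\<lambda>k j. if j = k then 1 else 0 :: real"
  let ?D = "\<lambda>k i. hg_alg \<gamma>1 \<gamma>2 h a b (?e k) m i x"
  define A where "A = gamma_det \<gamma>1 \<gamma>2 (x - real m * h) (b - real i * h)
    / gamma_det \<gamma>1 \<gamma>2 (a - real (i + m) * h) (b - real i * h)"
  define B where "B = gamma_det \<gamma>1 \<gamma>2 (a - real (i + m) * h) (x - real m * h)
    / gamma_det \<gamma>1 \<gamma>2 (a - real (i + m) * h) (b - real i * h)"
  have step: "hg_alg \<gamma>1 \<gamma>2 h a b Q (Suc m) i x
      = A * hg_alg \<gamma>1 \<gamma>2 h a b Q m i x + B * hg_alg \<gamma>1 \<gamma>2 h a b Q m (Suc i) x" for Q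
    by (simp add: A_def B_def)
  have zero: "?D k l = 0" if "k \<notin> {l..l + m}" for k l
    by (subst Suc.IH, rule sum.neutral) (use that in auto)
  have range: "hg_alg \<gamma>1 \<gamma>2 h a b P m l x = (\<Sum>k=i..i + Suc m. P k * ?D k l)"
    if "l = i \<or> l = Suc i" for l
    by (subst Suc.IH, rule sum.mono_neutral_left) (use that zero in auto)
  have "A * (\<Sum>k=i..i + Suc m. P k * ?D k i) + B * (\<Sum>k=i..i + Suc m. P k * ?D k (Suc i))
      = (\<Sum>k=i..i + Suc m. P k * (A * ?D k i + B * ?D k (Suc i)))"
    unfolding sum_distrib_left sum.distrib[symmetric]
    by (rule sum.cong) (simp_all only: algebra_simps)
  then show ?case
    unfolding step by (simp only: range simp_thms)
qed

lemma hg_alg_expansion: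
  "hg_alg \<gamma>1 \<gamma>2 h a b P n 0 x = (\<Sum>k=0..n. P k * hg_bernstein \<gamma>1 \<gamma>2 h a b n k x)"
  using hg_alg_linear[of \<gamma>1 \<gamma>2 h a b P n 0 x] by (simp add: hg_bernstein_def)

lemma hg_bernstein_unique:
  assumes "\<And>P. hg_alg \<gamma>1 \<gamma>2 h a b P n 0 x = (\<Sum>k=0..n. P k * c k)" and "k \<le> n"
  shows "c k = hg_bernstein \<gamma>1 \<gamma>2 h a b n k x"
  using assms(2) unfolding hg_bernstein_def assms(1) by (simp add: if_distrib if_distribR cong: if_cong)

definition control_points :: "(real \<Rightarrow> real) \<Rightarrow> (real \<Rightarrow> real) \<Rightarrow> real \<Rightarrow> real \<Rightarrow> real \<Rightarrow> nat \<Rightarrow>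
    (real \<Rightarrow> real) \<Rightarrow> (nat \<Rightarrow> real) \<Rightarrow> bool" where
  "control_points \<gamma>1 \<gamma>2 h a b n G P \<longleftrightarrow>
     (\<forall>x. G x = (\<Sum>k=0..n. P k * hg_bernstein \<gamma>1 \<gamma>2 h a b n k x))"

end

theory Submission imports Defs
begin

text \<open>
  Write \<open>v\<^sub>r = a - r h\<close>. For every \<open>w\<close>, the Pluecker relation between the three brackets of a
  recursion step shows that the algorithm, run on the initial values
  \<open>P\<^sub>j = (\<Prod>r=j..<j+n. d(v\<^sub>r, w))\<close>, returns \<open>(\<Prod>r<n. d(x - r h, w))\<close>. For \<open>b = v\<^sub>n\<close> and
  \<open>x = v\<^sub>m\<close> this is \<open>P\<^sub>m\<close>. Taking \<open>w = v\<^sub>l\<^sub>-\<^sub>1\<close> for \<open>l = 0, \<dots>, n\<close> gives a triangular family of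
  initial values, hence a basis of all of them; its diagonal entries do not vanish, because
  translation changes \<open>d\<close> only by a nonzero factor.
\<close>

text \<open>The matrix \<open>C\<close> multiplies the bracket by its nonzero determinant. This
  carries nonvanishing from the pairs of points in the hypotheses to every pair with the same
  gap.\<close>

lemma gamma_det_translate:
  assumes "translation_invariant \<gamma>1 \<gamma>2"
  shows "gamma_det \<gamma>1 \<gamma>2 (u - s) (v - s) = 0 \<longleftrightarrow> gamma_det \<gamma>1 \<gamma>2 u v = 0"
proof -
  obtain C :: "real^2^2" where C: "invertible C"
    and eq: "\<And>x. vector [\<gamma>1 (x - s), \<gamma>2 (x - s)] = C *v vector [\<gamma>1 x, \<gamma>2 x]"
    using assms unfolding translation_invariant_def by blast
  have g1: "\<gamma>1 (x - s) = C $ 1 $ 1 * \<gamma>1 x + C $ 1 $ 2 * \<gamma>2 x" for x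
    using arg_cong[OF eq[of x], of "\<lambda>z. z $ 1"] by (simp add: matrix_vector_mult_def sum_2)
  have g2: "\<gamma>2 (x - s) = C $ 2 $ 1 * \<gamma>1 x + C $ 2 $ 2 * \<gamma>2 x" for x
    using arg_cong[OF eq[of x], of "\<lambda>z. z $ 2"] by (simp add: matrix_vector_mult_def sum_2)
  have "gamma_det \<gamma>1 \<gamma>2 (u - s) (v - s) = det C * gamma_det \<gamma>1 \<gamma>2 u v"
    unfolding gamma_det_def g1 g2 det_2 by (simp add: algebra_simps)
  moreover have "det C \<noteq> 0" using C by (simp add: invertible_det_nz)
  ultimately show ?thesis by simp
qed

lemma gamma_det_Pluecker:
  "gamma_det \<gamma>1 \<gamma>2 x b * gamma_det \<gamma>1 \<gamma>2 a w + gamma_det \<gamma>1 \<gamma>2 a x * gamma_det \<gamma>1 \<gamma>2 b w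
     = gamma_det \<gamma>1 \<gamma>2 a b * gamma_det \<gamma>1 \<gamma>2 x w"
  unfolding gamma_det_def by (simp add: algebra_simps)

lemma gamma_det_commute: "gamma_det \<gamma>1 \<gamma>2 u v = - gamma_det \<gamma>1 \<gamma>2 v u"
  unfolding gamma_det_def by simp

text \<open>The first product splits at \<open>n\<close>, where the points \<open>a - r h\<close> continue as \<open>b, b - h, \<dots>\<close>.\<close>

lemma hg_alg_prod_gamma_det:
  assumes nz: "\<And>i j. i \<le> j \<Longrightarrow> j \<le> n - 1 \<Longrightarrow>
      gamma_det \<gamma>1 \<gamma>2 (a - real j * h) (b - real i * h) \<noteq> 0"
    and b: "b = a - real n * h" and "i + k \<le> n"
  shows "hg_alg \<gamma>1 \<gamma>2 h a b (\<lambda>j. \<Prod>r=j..<j+n. gamma_det \<gamma>1 \<gamma>2 (a - real r * h) w) k i x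
    = (\<Prod>r=i+k..<i+n. gamma_det \<gamma>1 \<gamma>2 (a - real r * h) w)
      * (\<Prod>r<k. gamma_det \<gamma>1 \<gamma>2 (x - real r * h) w)"
  using \<open>i + k \<le> n\<close>
proof (induction k arbitrary: i)
  case 0
  then show ?case by simp
next
  case (Suc k)
  let ?d = "gamma_det \<gamma>1 \<gamma>2"
  define A where "A = a - real (i + k) * h"
  define B where "B = b - real i * h"
  define X where "X = x - real k * h"
  \<comment> \<open>\<open>R\<close> collects the factors common to the products for
    \<open>i\<close> and \<open>Suc i\<close>. The former has the extra factor at
    \<open>r = i + k\<close>, the point \<open>A\<close>; the latter the one at
    \<open>r = i + n\<close>, the point \<open>B\<close>.\<close>
  define R where "R = (\<Prod>r=Suc i+k..<i+n. ?d (a - real r * h) w)"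
  define T where "T = (\<Prod>r<k. ?d (x - real r * h) w)"
  have AB: "?d A B \<noteq> 0"
    unfolding A_def B_def using nz[of i "i + k"] Suc.prems by simp
  have low: "(\<Prod>r=i+k..<i+n. ?d (a - real r * h) w) = ?d A w * R"
    unfolding A_def R_def using Suc.prems by (subst prod.atLeast_Suc_lessThan) auto
  have "a - real (i + n) * h = B"
    unfolding B_def b by (simp add: algebra_simps)
  then have high: "(\<Prod>r=Suc i+k..<Suc i+n. ?d (a - real r * h) w) = R * ?d B w"
    unfolding R_def using Suc.prems by simp
  have IH1: "hg_alg \<gamma>1 \<gamma>2 h a b (\<lambda>j. \<Prod>r=j..<j+n. ?d (a - real r * h) w) k i x
      = ?d A w * R * T"
    using Suc.IH[of i] Suc.prems unfolding low T_def by simp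
  have IH2: "hg_alg \<gamma>1 \<gamma>2 h a b (\<lambda>j. \<Prod>r=j..<j+n. ?d (a - real r * h) w) k (Suc i) x
      = R * ?d B w * T"
    using Suc.IH[of "Suc i"] Suc.prems unfolding high T_def by simp
  have "?d X B / ?d A B * (?d A w * R * T) + ?d A X / ?d A B * (R * ?d B w * T)
      = (?d X B * ?d A w + ?d A X * ?d B w) * R * T / ?d A B"
    by (simp add: algebra_simps add_divide_distrib)
  also have "\<dots> = R * (T * ?d X w)"
    unfolding gamma_det_Pluecker using AB by simp
  finally have "hg_alg \<gamma>1 \<gamma>2 h a b (\<lambda>j. \<Prod>r=j..<j+n. ?d (a - real r * h) w) (Suc k) i x
      = R * (T * ?d X w)"
    unfolding hg_alg.simps IH1 IH2 A_def B_def X_def .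
  then show ?case
    unfolding R_def T_def X_def by simp
qed

text \<open>Descending induction on \<open>l\<close>: in row \<open>l\<close> the entries before the
  diagonal vanish, and the coefficients after it are zero by induction, so only
  \<open>c l * p l l\<close> remains.\<close>

lemma triangular_annihilator_zero:
  fixes c :: "nat \<Rightarrow> 'a::idom"
  assumes ann: "\<And>l. l \<le> n \<Longrightarrow> (\<Sum>j=0..n. c j * p l j) = 0"
    and low: "\<And>l j. j < l \<Longrightarrow> l \<le> n \<Longrightarrow> p l j = 0"
    and diag: "\<And>l. l \<le> n \<Longrightarrow> p l l \<noteq> 0"
    and "l \<le> n"
  shows "c l = 0"
  using \<open>l \<le> n\<close>
proof (induction "n - l" arbitrary: l rule: less_induct)
  case less
  have "c j * p l j = 0" if "j \<in> {0..n} - {l}" for j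
    using that less low[of j l] by (cases "j < l") auto
  then have "(\<Sum>j=0..n. c j * p l j) = c l * p l l"
    using less.prems by (simp add: sum.remove[of _ l] sum.neutral)
  then show ?case using ann diag less.prems by auto
qed

lemma hg_alg_interpolates:
  assumes inv: "translation_invariant \<gamma>1 \<gamma>2"
    and nz: "\<And>i j. i \<le> j \<Longrightarrow> j \<le> n - 1 \<Longrightarrow>
      gamma_det \<gamma>1 \<gamma>2 (a - real j * h) (b - real i * h) \<noteq> 0"
    and b: "b = a - real n * h" and "m \<le> n"
  shows "hg_alg \<gamma>1 \<gamma>2 h a b P n 0 (a - real m * h) = P m"
proof -
  let ?d = "gamma_det \<gamma>1 \<gamma>2"
  let ?x = "a - real m * h"
  \<comment> \<open>The subtraction in \<open>real l - 1\<close> is real, so \<open>l = 0\<close>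
    gives the extra point \<open>a + h\<close>.\<close>
  define p where "p l j = (\<Prod>r=j..<j+n. ?d (a - real r * h) (a - (real l - 1) * h))" for l j
  \<comment> \<open>These are the coefficients of the linear form sending \<open>Q\<close> to the
    interpolation error at \<open>?x\<close>; the goal is that all of them vanish.\<close>
  define c where "c j = hg_bernstein \<gamma>1 \<gamma>2 h a b n j ?x - (if j = m then 1 else 0)" for j
  have error: "(\<Sum>j=0..n. c j * Q j) = hg_alg \<gamma>1 \<gamma>2 h a b Q n 0 ?x - Q m" for Q
  proof -
    have "(\<Sum>j=0..n. c j * Q j) = (\<Sum>j=0..n. Q j * hg_bernstein \<gamma>1 \<gamma>2 h a b n j ?x)
        - (\<Sum>j=0..n. if j = m then Q j else 0)"
      unfolding sum_subtractf[symmetric] c_def by (rule sum.cong) (auto simp: algebra_simps)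
    then show ?thesis using \<open>m \<le> n\<close> by (simp add: hg_alg_expansion)
  qed
  have "(\<Sum>j=0..n. c j * p l j) = 0" for l
  proof -
    have "hg_alg \<gamma>1 \<gamma>2 h a b (p l) n 0 ?x
        = (\<Prod>r<n. ?d (?x - real r * h) (a - (real l - 1) * h))"
      unfolding p_def using hg_alg_prod_gamma_det[OF nz b, of 0 n _ ?x] by simp
    also have "\<dots> = p l m"
      unfolding p_def
      by (rule prod.reindex_bij_witness[of _ "\<lambda>r. r - m" "\<lambda>r. r + m"])
        (auto simp: algebra_simps)
    finally show ?thesis unfolding error by simp
  qed
  moreover have "p l j = 0" if "j < l" "l \<le> n" for l j
    unfolding p_def
  proof (rule prod_zero)
    show "\<exists>r\<in>{j..<j+n}. ?d (a - real r * h) (a - (real l - 1) * h) = 0"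
      \<comment> \<open>At \<open>r = l - 1\<close> both arguments of the bracket coincide. This
        index lies in the range since \<open>j < l\<close> and \<open>l \<le> n\<close>; for
        \<open>j = l\<close> the range starts just after it.\<close>
      using that by (intro bexI[of _ "l - 1"]) (auto simp: gamma_det_def of_nat_diff)
  qed simp
  moreover have "p l l \<noteq> 0" for l
  proof -
    have "?d (a - real r * h) (a - (real l - 1) * h) \<noteq> 0" if r: "r \<in> {l..<l+n}" for r
    proof -
      \<comment> \<open>\<open>s\<close> is the gap between the indices \<open>r\<close> and
        \<open>l - 1\<close>. The points with indices \<open>n - s\<close> and \<open>n\<close> have
        the same gap, and \<open>nz\<close> applies to them because \<open>1 \<le> s\<close>; a
        translation by \<open>(r - n) * h\<close> then gives the required pair.\<close>
      define s where "s = Suc r - l"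
      have s: "1 \<le> s" "s \<le> n" "real s = real r + 1 - real l"
        using r by (auto simp: s_def)
      have "?d (a - real (n - s) * h) b \<noteq> 0"
        using nz[of 0 "n - s"] s by simp
      then have "?d (a - real (n - s) * h - (real r - real n) * h) (b - (real r - real n) * h) \<noteq> 0"
        using gamma_det_translate[OF inv] by blast
      also have "a - real (n - s) * h - (real r - real n) * h = a - (real l - 1) * h"
      proof -
        have "real l = real r + 1 - real s" using s by simp
        then show ?thesis unfolding of_nat_diff[OF s(2)] by (simp only:) (simp add: algebra_simps)
      qed
      also have "b - (real r - real n) * h = a - real r * h"
        unfolding b by (simp add: algebra_simps)
      finally show ?thesis by (subst gamma_det_commute) simp
    qed
    then show ?thesis unfolding p_def by simp
  qed
  ultimately have "c j = 0" if "j \<le> n" for j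
    using triangular_annihilator_zero[of n c p] that by blast
  then have "(\<Sum>j=0..n. c j * P j) = 0" by simp
  then show ?thesis unfolding error by simp
qed

theorem corollary5p14:
  fixes n :: nat and h a b :: real
    and \<gamma>1 \<gamma>2 G :: "real \<Rightarrow> real" and P :: "nat \<Rightarrow> real"
  assumes "n \<ge> 1"
    and "continuous_on UNIV \<gamma>1" and "continuous_on UNIV \<gamma>2"
    and "\<gamma>1 \<noteq> \<gamma>2" and "\<not> real_fun.dependent {\<gamma>1, \<gamma>2}"
    and "translation_invariant \<gamma>1 \<gamma>2"
    and "lin_indep_family (G_fun \<gamma>1 \<gamma>2 h n) {0..n}"
    and "\<And>i j. i \<le> j \<Longrightarrow> j \<le> n - 1 \<Longrightarrow>
           gamma_det \<gamma>1 \<gamma>2 (a - real j * h) (b - real i * h) \<noteq> 0"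
    and "G \<in> gamma_space n \<gamma>1 \<gamma>2"
    and "control_points \<gamma>1 \<gamma>2 h a b n G P"
    and "b = a - real n * h" and "h \<noteq> 0"
  shows "\<forall>k\<le>n. G (a - real k * h) = P k"
  using hg_alg_interpolates[OF assms(6,8,11)] assms(10)
  by (simp add: control_points_def hg_alg_expansion[symmetric])

end
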